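(* Let $p$ be a prime, $m\ge2$, and let $C$ be the $(m-1)p\times p$ matrix over $\mathbb F_2$ obtained by stacking vertically circulant $p\times p$ matrices $C_1,\dots,C_{m-1}$. Suppose every column of $C$ has weight $t$, every row of $C$ has weight $t_r\ge2$, at least one $C_i$ is invertible over $\mathbb F_2$, any two distinct columns of $C$ have at most one position in which both entries equal $1$, and $t\cdot t_r\le p-1$. Let $\mathrm G=\{\mathcal P_2\in S_p:\ \exists\,\mathcal P_1\in S_{(m-1)p},\ \mathcal P_1C\mathcal P_2=C\}$. Then the minimal degree of $\mathrm G$ is at least $p-1$.
   Context: The weight of a vector is its number of nonzero entries. A $p\times p$ matrix is circulant if every row except the first is the cyclic right shift of the row above it. $S_n$ is identified with the group of $n\times n$ permutation matrices. The minimal degree of a permutation group is the minimum number of points moved by a non-identity element of the group. *)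

theory Defs
  imports
    Jordan_Normal_Form.Matrix
    "HOL-Library.Z2"
    "HOL-Combinatorics.Permutations"
    "HOL-Computational_Algebra.Primes"
begin

text \<open>The field with two elements is the type \<^typ>\<open>bit\<close>. Matrix indices start at 0.\<close>

definition weight :: "'a::zero vec \<Rightarrow> nat" where
  "weight v = card {i. i < dim_vec v \<and> v $ i \<noteq> 0}"

definition circulant :: "'a mat \<Rightarrow> bool" where
  "circulant A \<longleftrightarrow> square_mat A \<and>
     (\<forall>i j. Suc i < dim_row A \<longrightarrow> j < dim_col A \<longrightarrow>
        A $$ (Suc i, Suc j mod dim_col A) = A $$ (i, j))"

text \<open>The matrix with row blocks \<^term>\<open>B 0\<close>, \dots, \<^term>\<open>B (k - 1)\<close>, each of size
  \<^term>\<open>r\<close> by \<^term>\<open>c\<close>, from top to bottom.\<close>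

definition stack_blocks :: "nat \<Rightarrow> nat \<Rightarrow> nat \<Rightarrow> (nat \<Rightarrow> 'a mat) \<Rightarrow> 'a mat" where
  "stack_blocks k r c B = mat (k * r) c (\<lambda>(i, j). B (i div r) $$ (i mod r, j))"

text \<open>The matrix sending the \<^term>\<open>j\<close>-th unit vector to the \<^term>\<open>\<sigma> j\<close>-th one, so that
  composition of permutations corresponds to the matrix product.\<close>

definition permutation_mat :: "nat \<Rightarrow> (nat \<Rightarrow> nat) \<Rightarrow> 'a::{zero,one} mat" where
  "permutation_mat n \<sigma> = mat n n (\<lambda>(i, j). if i = \<sigma> j then 1 else 0)"

definition column_group :: "'a::semiring_1 mat \<Rightarrow> (nat \<Rightarrow> nat) set" where
  "column_group C = {\<sigma>. \<sigma> permutes {..<dim_col C} \<and>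
     (\<exists>\<pi>. \<pi> permutes {..<dim_row C} \<and>
        permutation_mat (dim_row C) \<pi> * C * permutation_mat (dim_col C) \<sigma> = C)}"

text \<open>Meant for a finite group \<^term>\<open>G\<close> of permutations of a finite set, extended by the identity
  outside that set. For trivial \<^term>\<open>G\<close> the set below is empty and its minimum is
  unspecified, so that no positive lower bound is provable in that case.\<close>

definition minimal_degree :: "('a \<Rightarrow> 'a) set \<Rightarrow> nat" where
  "minimal_degree G = Min {card {x. g x \<noteq> x} | g. g \<in> G \<and> g \<noteq> id}"

end

theory Submission
  imports Defs "HOL-Computational_Algebra.Polynomial" "HOL-Number_Theory.Residues"
begin

hide_const (open) up_ring.coeff up_ring.monom

text \<open>
  Call two columns adjacent if they share a nonzero row position. The group preserves adjacency and
  contains the cyclic shift, so adjacency of two columns depends only on their difference modulo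
  $p$; let $U$ be the set of nonzero differences of adjacent columns. It is nonempty since
  $t_r \ge 2$, and counting gives $|U| \le t(t_r - 1) < p - 1$. Mueller's polynomial argument for
  Burnside's theorem on groups of prime degree shows that every permutation of
  $\mathbb{F}_p$ preserving such a difference set is affine, and a nontrivial affine map
  has at most one fixed point.

  For Mueller's argument, pass to the complement of $U$ if necessary, so that
  $|U| \le (p - 1)/2$, and let $r \le |U|$ be the least positive exponent whose power sum over $U$
  does not vanish. The operator sending $f$ to $\sum_{u \in U} (f(x + u) - f(x))$ commutes with
  composition by $h$, and among polynomials of degree less than $p$ its values are
  constant exactly for those of degree at most $r$. Hence $h^j$ has degree at most $r$ for
  $j \le r$. If $n \ge 2$ is the degree of $h$, then $j = \lfloor r/n \rfloor + 1$ gives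
  $r < jn \le 2r < p$, a contradiction.
\<close>

section \<open>Polynomials modulo a prime\<close>

text \<open>A nonzero polynomial over a field has no more roots than its degree. For the field with
  \<open>q\<close> elements this is phrased through integer polynomials and divisibility.\<close>

lemma coeff_dvd_if_poly_dvd:
  fixes h :: "int poly" and q :: int
  assumes "prime q" "int (degree h) < q" "\<And>x. q dvd poly h x"
  shows "q dvd coeff h i"
proof -
  \<comment> \<open>Vanishing is demanded only at 0, ..., n: after the root n + 1 is split off, the
    quotient is known to vanish only at the points that remain.\<close>
  have "q dvd coeff h i" if "prime q" "degree h \<le> n" "int n < q"
    "\<And>x. 0 \<le> x \<Longrightarrow> x \<le> int n \<Longrightarrow> q dvd poly h x" for n and h :: "int poly" and i
    using that
  proof (induction n arbitrary: h i)
    case 0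
    then obtain c where h: "h = [:c:]"
      by (metis degree_eq_zeroE le_zero_eq)
    have "q dvd poly h 0"
      using 0(4)[of 0] by simp
    then show ?case
      unfolding h by (simp add: coeff_pCons split: nat.split)
  next
    case (Suc n)
    let ?a = "1 + int n"
    let ?g = "synthetic_div h ?a"
    have h: "h = [:- ?a, 1:] * ?g + [:poly h ?a:]"
      using synthetic_div_correct'[of ?a h] by simp
    have a: "q dvd poly h ?a"
      using Suc.prems(4)[of ?a] by simp
    have "q dvd coeff ?g j" for j
    proof (rule Suc.IH)
      fix x :: int
      assume x: "0 \<le> x" "x \<le> int n"
      have "poly h x = (x - ?a) * poly ?g x + poly h ?a"
        by (subst h) (simp add: algebra_simps)
      moreover have "q dvd poly h x"
        using Suc.prems(4)[of x] x by simp
      ultimately have "q dvd (x - ?a) * poly ?g x"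
        using a by (metis add_diff_cancel_right' dvd_diff)
      moreover have "\<not> q dvd x - ?a"
        using zdvd_not_zless[of "?a - x" q] x Suc.prems(3) by (simp add: dvd_diff_commute)
      ultimately show "q dvd poly ?g x"
        using \<open>prime q\<close> by (simp add: prime_dvd_mult_iff)
    qed (use Suc.prems degree_synthetic_div[of h ?a] in auto)
    then show ?case
      using a by (subst h) (simp add: coeff_pCons split: nat.split)
  qed
  from this[of h "degree h" i] show ?thesis
    using assms by simp
qed

lemma fermat_int:
  fixes x :: int
  assumes "prime p" "\<not> int p dvd x"
  shows "[x ^ (p - 1) = 1] (mod int p)"
proof -
  have *: "int (nat (x mod int p)) = x mod int p"
    using assms(1) by (simp add: prime_gt_0_nat)
  have "\<not> p dvd nat (x mod int p)"
    using assms(2) * by (metis dvd_mod_iff dvd_refl int_dvd_int_iff)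
  then have "[nat (x mod int p) ^ (p - 1) = 1] (mod p)"
    using fermat_theorem assms(1) by blast
  then have "[int (nat (x mod int p)) ^ (p - 1) = 1] (mod int p)"
    by (metis cong_int_iff of_nat_1 of_nat_power)
  then have "[(x mod int p) ^ (p - 1) = 1] (mod int p)"
    unfolding * .
  then show ?thesis
    by (simp add: cong_def power_mod)
qed

text \<open>By Fermat, 1 - (x - a)^(p - 1) is modulo \<open>p\<close> the indicator of the residue
  class of \<open>a\<close>; weighting these polynomials by \<open>h a\<close> interpolates
  \<open>h\<close>.\<close>

lemma interpolation_mod_prime:
  fixes h :: "int \<Rightarrow> int"
  assumes p: "prime p" and h: "\<And>x y. [x = y] (mod int p) \<Longrightarrow> [h x = h y] (mod int p)"
  obtains g where "degree g < p" "\<And>x. [poly g x = h x] (mod int p)"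
    "degree g = 0 \<or> \<not> int p dvd lead_coeff g"
proof -
  have p0: "0 < p" using p by (simp add: prime_gt_0_nat)
  define P where "P g \<longleftrightarrow> degree g < p \<and> (\<forall>x. [poly g x = h x] (mod int p))" for g
  define g where "g = (\<Sum>a\<in>{0..<int p}. smult (h a) (1 - [:- a, 1:] ^ (p - 1)))"
  have "degree (1 - [:- a, 1:] ^ (p - 1)) \<le> p - 1" for a :: int
    by (intro degree_diff_le) (simp_all add: degree_linear_power)
  then have "degree g \<le> p - 1"
    unfolding g_def by (intro degree_sum_le) (auto intro: order_trans[OF degree_smult_le])
  moreover have "[poly g x = h x] (mod int p)" for x
  proof -
    have "poly g x = (\<Sum>a\<in>{0..<int p}. h a * (1 - (x - a) ^ (p - 1)))"
      by (simp add: g_def poly_sum algebra_simps)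
    also have "[\<dots> = (\<Sum>a\<in>{0..<int p}. if a = x mod int p then h x else 0)] (mod int p)"
    proof (rule cong_sum)
      fix a assume a: "a \<in> {0..<int p}"
      show "[h a * (1 - (x - a) ^ (p - 1)) = (if a = x mod int p then h x else 0)] (mod int p)"
      proof (cases "a = x mod int p")
        case True
        then have xa: "[x = a] (mod int p)"
          by (simp add: cong_def)
        then have "[(x - a) ^ (p - 1) = 0 ^ (p - 1)] (mod int p)"
          by (intro cong_pow) (simp add: cong_iff_dvd_diff)
        moreover have "(0 :: int) ^ (p - 1) = 0"
          using prime_gt_1_nat[OF p] by simp
        ultimately have "[(x - a) ^ (p - 1) = 0] (mod int p)"
          by metis
        then have "[h a * (1 - (x - a) ^ (p - 1)) = h x * (1 - 0)] (mod int p)"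
          using h[OF xa] by (intro cong_mult cong_diff) (auto simp: cong_sym)
        then show ?thesis
          using True by simp
      next
        case False
        then have "\<not> [x = a] (mod int p)"
          using a by (auto simp: cong_def)
        then have "[(x - a) ^ (p - 1) = 1] (mod int p)"
          using p by (intro fermat_int) (auto simp: cong_iff_dvd_diff)
        then have "[h a * (1 - (x - a) ^ (p - 1)) = h a * (1 - 1)] (mod int p)"
          by (intro cong_mult cong_diff) auto
        then show ?thesis
          using False by simp
      qed
    qed
    also have "(\<Sum>a\<in>{0..<int p}. if a = x mod int p then h x else 0) = h x"
      using p0 by simp
    finally show ?thesis .
  qed
  ultimately have "P g"
    using p0 unfolding P_def by auto
  \<comment> \<open>In an interpolant of least degree the leading coefficient is nonzero modulo
    \<open>p\<close>, since the leading term could otherwise be dropped. In degree 0 dropping it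
    does not lower the degree, hence the exception in the conclusion.\<close>
  then obtain g where g: "P g" and min: "\<And>g'. P g' \<Longrightarrow> degree g \<le> degree g'"
    using ex_has_least_nat[of P g degree] by blast
  have "\<not> int p dvd lead_coeff g" if "degree g \<noteq> 0"
  proof
    assume "int p dvd lead_coeff g"
    let ?m = "monom (lead_coeff g) (degree g)"
    have deg: "degree (g - ?m) < degree g"
      using that by (intro degree_lessI) (auto simp: coeff_eq_0 le_less)
    have "[poly (g - ?m) x = poly g x - 0] (mod int p)" for x
      unfolding poly_diff poly_monom using \<open>int p dvd lead_coeff g\<close>
      by (intro cong_diff) (auto simp: cong_0_iff)
    then have "P (g - ?m)"
      using g deg unfolding P_def by (auto intro: cong_trans)
    with min deg show False
      by (meson not_le)
  qed
  with g show thesis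
    by (intro that[of g]) (auto simp: P_def)
qed

section \<open>Permutations preserving a difference set\<close>

text \<open>If all these power sums vanished modulo \<open>p\<close>, so would the sum over
  \<open>U\<close> of every polynomial of degree at most |U| without constant term. But such a
  polynomial can be zero at all points of \<open>U\<close> except one.\<close>

lemma exists_power_sum_not_dvd:
  fixes U :: "int set"
  assumes "prime p" "U \<subseteq> {1..<int p}" "U \<noteq> {}"
  shows "\<exists>r. 1 \<le> r \<and> r \<le> card U \<and> \<not> int p dvd (\<Sum>u\<in>U. u ^ r)"
proof (rule ccontr)
  assume "\<not> ?thesis"
  then have *: "int p dvd (\<Sum>u\<in>U. u ^ r)" if "1 \<le> r" "r \<le> card U" for r
    using that by blast
  have fin: "finite U"
    using assms(2) finite_subset by blast
  obtain w where w: "w \<in> U"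
    using assms(3) by blast
  \<comment> \<open>The factor x removes the constant term, whose power sum |U| is not among those
    assumed to vanish.\<close>
  define q where "q = [:0, 1:] * (\<Prod>v\<in>U - {w}. [:- v, 1:])"
  have "degree q \<le> 1 + degree (\<Prod>v\<in>U - {w}. [:- v, 1:])"
    unfolding q_def using degree_mult_le[of "[:0, 1:]" "\<Prod>v\<in>U - {w}. [:- v, 1:]"] by simp
  also have "\<dots> \<le> 1 + (\<Sum>v\<in>U - {w}. degree [:- v, 1:])"
    using degree_prod_sum_le[of "U - {w}" "\<lambda>v. [:- v, 1:]"] fin
    unfolding o_def by (intro add_left_mono) blast
  also have "\<dots> = card U"
    using card.remove[OF fin w] by simp
  finally have deg: "degree q \<le> card U" .
  have q: "poly q x = x * (\<Prod>v\<in>U - {w}. x - v)" for x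
    by (simp add: q_def poly_prod)
  have "(\<Sum>u\<in>U. poly q u) = poly q w + (\<Sum>u\<in>U - {w}. poly q u)"
    using fin w by (rule sum.remove)
  also have "(\<Sum>u\<in>U - {w}. poly q u) = 0"
    using fin by (intro sum.neutral) (auto simp: q)
  finally have "(\<Sum>u\<in>U. poly q u) = poly q w"
    by simp
  moreover have "(\<Sum>u\<in>U. poly q u) = (\<Sum>i\<le>degree q. coeff q i * (\<Sum>u\<in>U. u ^ i))"
    unfolding poly_altdef by (subst sum.swap) (simp add: sum_distrib_left)
  moreover have "int p dvd (\<Sum>i\<le>degree q. coeff q i * (\<Sum>u\<in>U. u ^ i))"
  proof (rule dvd_sum)
    fix i assume i: "i \<in> {..degree q}"
    show "int p dvd coeff q i * (\<Sum>u\<in>U. u ^ i)"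
      using i deg *[of i] by (cases "i = 0") (auto simp: q_def)
  qed
  ultimately have "int p dvd w * (\<Prod>v\<in>U - {w}. w - v)"
    by (simp add: q)
  moreover have "\<not> int p dvd w"
    using w assms(2) by (auto dest!: zdvd_imp_le)
  moreover have "\<not> int p dvd w - v" if "v \<in> U - {w}" for v
  proof -
    have "w mod int p = w" "v mod int p = v"
      using that w assms(2) by auto
    then show ?thesis
      using that by (auto simp: mod_eq_dvd_iff[symmetric])
  qed
  ultimately show False
    using assms(1) fin by (auto simp: prime_dvd_mult_iff prime_dvd_prod_iff)
qed

section \<open>Sums of polynomials over the shifts by a set\<close>

lemma sum_power_shift:
  fixes x :: "'a::comm_ring_1"
  shows "(\<Sum>u\<in>U. (x + u) ^ j - x ^ j) =
    (\<Sum>k<j. of_nat (j choose k) * (\<Sum>u\<in>U. u ^ (j - k)) * x ^ k)"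
proof -
  \<comment> \<open>In the binomial expansion the term with k = j cancels against x^j.\<close>
  have "(x + u) ^ j - x ^ j = (\<Sum>k<j. of_nat (j choose k) * x ^ k * u ^ (j - k))" for u
    unfolding binomial_ring by (simp flip: lessThan_Suc_atMost)
  then show ?thesis
    by (simp add: sum.swap[of _ _ U] sum_distrib_left sum_distrib_right mult_ac)
qed

text \<open>The coefficient of x^k contains the power sum of exponent j - k, which for 0 < k < j is
  positive and below \<open>r\<close>. So only k = 0 survives.\<close>

lemma shift_sum_power_const:
  fixes U :: "int set" and q :: int
  assumes "\<And>k. 1 \<le> k \<Longrightarrow> k < r \<Longrightarrow> q dvd (\<Sum>u\<in>U. u ^ k)" "1 \<le> j" "j \<le> r"
  shows "[(\<Sum>u\<in>U. (x + u) ^ j - x ^ j) = (\<Sum>u\<in>U. u ^ j)] (mod q)"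
proof -
  have "[(\<Sum>k<j. int (j choose k) * (\<Sum>u\<in>U. u ^ (j - k)) * x ^ k) =
      (\<Sum>k<j. if k = 0 then \<Sum>u\<in>U. u ^ j else 0)] (mod q)"
  proof (rule cong_sum)
    fix k assume "k \<in> {..<j}"
    then show "[int (j choose k) * (\<Sum>u\<in>U. u ^ (j - k)) * x ^ k =
        (if k = 0 then \<Sum>u\<in>U. u ^ j else 0)] (mod q)"
      using assms(1)[of "j - k"] \<open>j \<le> r\<close> by (cases "k = 0") (auto simp: cong_0_iff)
  qed
  then show ?thesis
    using \<open>1 \<le> j\<close> by (simp add: sum_power_shift)
qed

text \<open>With d the degree of \<open>f\<close>, the coefficient of x^(d - r) in the sum is modulo
  \<open>p\<close> a product of three nonzero residues: the leading coefficient, a binomial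
  coefficient and the power sum of exponent \<open>r\<close>. Since r < d, it is not the constant
  coefficient, so \<open>c\<close> cannot cancel it.\<close>

lemma shift_sum_poly_not_const:
  fixes f :: "int poly" and U :: "int set"
  assumes p: "prime p" and r: "1 \<le> r" "\<not> int p dvd (\<Sum>u\<in>U. u ^ r)"
    and least: "\<And>k. 1 \<le> k \<Longrightarrow> k < r \<Longrightarrow> int p dvd (\<Sum>u\<in>U. u ^ k)"
    and f: "r < degree f" "degree f < p" "\<not> int p dvd lead_coeff f"
  shows "\<exists>x. \<not> [(\<Sum>u\<in>U. poly f (x + u) - poly f x) = c] (mod int p)"
proof (rule ccontr)
  assume "\<not> ?thesis"
  then have const: "[(\<Sum>u\<in>U. poly f (x + u) - poly f x) = c] (mod int p)" for x
    by blast
  define d where "d = degree f"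
  define b where "b j k = coeff f j * int (j choose k) * (\<Sum>u\<in>U. u ^ (j - k))" for j k
  define H where "H = (\<Sum>j\<le>d. \<Sum>k<j. monom (b j k) k) - [:c:]"
  have "poly H x = (\<Sum>u\<in>U. poly f (x + u) - poly f x) - c" for x
  proof -
    have "(\<Sum>u\<in>U. poly f (x + u) - poly f x) =
        (\<Sum>u\<in>U. \<Sum>j\<le>d. coeff f j * ((x + u) ^ j - x ^ j))"
      by (simp add: poly_altdef d_def right_diff_distrib sum_subtractf)
    also have "\<dots> = (\<Sum>j\<le>d. coeff f j * (\<Sum>u\<in>U. (x + u) ^ j - x ^ j))"
      by (subst sum.swap) (simp add: sum_distrib_left)
    also have "\<dots> = (\<Sum>j\<le>d. \<Sum>k<j. b j k * x ^ k)"
      unfolding sum_power_shift b_def by (simp add: sum_distrib_left mult_ac)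
    finally show ?thesis
      by (simp add: H_def poly_sum poly_monom)
  qed
  then have "int p dvd poly H x" for x
    using const by (simp add: cong_iff_dvd_diff)
  moreover have "degree H \<le> d"
    unfolding H_def
    by (intro degree_diff_le degree_sum_le) (auto intro: order_trans[OF degree_monom_le])
  \<comment> \<open>\<open>H\<close> has degree below \<open>p\<close>, so vanishing everywhere
    modulo \<open>p\<close> forces each coefficient to vanish.\<close>
  ultimately have "int p dvd coeff H (d - r)"
    using coeff_dvd_if_poly_dvd[of "int p" H] p f(2) by (simp add: d_def)
  moreover have "coeff H (d - r) = (\<Sum>j\<le>d. if d - r < j then b j (d - r) else 0)"
  proof -
    have "coeff [:c:] (d - r) = 0"
      using f(1) by (simp add: coeff_pCons d_def split: nat.split)
    then show ?thesis
      by (simp add: H_def coeff_sum if_distrib[of "\<lambda>t. t = _"] cong: if_cong)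
  qed
  \<comment> \<open>For d - r < j < d the power sum in \<open>b j (d - r)\<close> has exponent
    between 1 and r - 1, hence vanishes by minimality of \<open>r\<close>.\<close>
  moreover have "[(\<Sum>j\<le>d. if d - r < j then b j (d - r) else 0) =
      (\<Sum>j\<le>d. if j = d then b d (d - r) else 0)] (mod int p)"
  proof (rule cong_sum)
    fix j assume "j \<in> {..d}"
    then have "int p dvd b j (d - r)" if "d - r < j" "j \<noteq> d"
      unfolding b_def using that f(1) by (intro dvd_mult least) (auto simp: d_def)
    then show "[(if d - r < j then b j (d - r) else 0) = (if j = d then b d (d - r) else 0)] (mod int p)"
      using r(1) f(1) by (auto simp: cong_0_iff d_def)
  qed
  ultimately have "int p dvd b d (d - r)"
    by (simp add: cong_dvd_iff)
  moreover have "\<not> int p dvd int (d choose (d - r))"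
  proof
    assume "int p dvd int (d choose (d - r))"
    then have "p dvd fact r * fact (d - r) * (d choose r)"
      using f(1) by (simp add: d_def flip: binomial_symmetric)
    then have "p dvd fact d"
      using binomial_fact_lemma[of r d] f(1) by (simp add: d_def)
    then show False
      using p f(2) by (simp add: d_def prime_dvd_fact_iff)
  qed
  ultimately show False
    unfolding b_def using p r f by (simp add: prime_dvd_mult_iff d_def)
qed

text \<open>\<open>h\<close> represents a permutation of the residues: \<open>inj\<close> says at
  once that it is well defined on them and injective. The bound on |U| gives 2r < p, which keeps the
  decisive power of the interpolating polynomial below degree \<open>p\<close>.\<close>

lemma difference_preserving_affine_if_card_le:
  fixes U :: "int set" and h :: "int \<Rightarrow> int"
  assumes p: "prime p" and U: "U \<subseteq> {1..<int p}" "U \<noteq> {}" "2 * card U < p"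
    and inj: "\<And>x y. [h x = h y] (mod int p) \<longleftrightarrow> [x = y] (mod int p)"
    and pres: "\<And>x y. (x - y) mod int p \<in> U \<Longrightarrow> (h x - h y) mod int p \<in> U"
  shows "\<exists>a b. \<forall>x. [h x = a * x + b] (mod int p)"
proof -
  have fin: "finite U"
    using U(1) finite_subset by blast
  have mod_U: "u mod int p = u" if "u \<in> U" for u
    using U(1) that by auto
  define Q where "Q r \<longleftrightarrow> 1 \<le> r \<and> \<not> int p dvd (\<Sum>u\<in>U. u ^ r)" for r
  define r where "r = (LEAST r. Q r)"
  obtain r' where r': "Q r'" "r' \<le> card U"
    using exists_power_sum_not_dvd[OF p U(1,2)] unfolding Q_def by blast
  have "Q r"
    unfolding r_def by (rule LeastI) (rule r'(1))
  have "r \<le> card U"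
    unfolding r_def using Least_le[of Q, OF r'(1)] r'(2) by linarith
  have least: "int p dvd (\<Sum>u\<in>U. u ^ k)" if "1 \<le> k" "k < r" for k
    using not_less_Least[of k Q] that unfolding r_def Q_def by blast

  have shift: "[(\<Sum>u\<in>U. h (x + u) ^ j - h x ^ j) = (\<Sum>u\<in>U. u ^ j)] (mod int p)"
    if j: "1 \<le> j" "j \<le> r" for x j
  proof -
    \<comment> \<open>\<open>\<phi>\<close> is an injective self-map of the finite set
      \<open>U\<close>, hence permutes it. Reindexing by it gives the shifted power sum at the point
      \<open>h x\<close>.\<close>
    define \<phi> where "\<phi> u = (h (x + u) - h x) mod int p" for u
    have "\<phi> ` U \<subseteq> U"
      using pres[of "x + _" x] mod_U by (auto simp: \<phi>_def)
    moreover have inj_\<phi>: "inj_on \<phi> U"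
    proof (rule inj_onI)
      fix u v assume "u \<in> U" "v \<in> U" "\<phi> u = \<phi> v"
      then have "[h (x + u) = h (x + v)] (mod int p)"
        unfolding \<phi>_def by (metis cong_def cong_add_rcancel diff_add_cancel)
      then have "[u = v] (mod int p)"
        by (simp add: inj cong_add_lcancel)
      then show "u = v"
        using mod_U \<open>u \<in> U\<close> \<open>v \<in> U\<close> by (simp add: cong_def)
    qed
    ultimately have im: "\<phi> ` U = U"
      using fin by (simp add: endo_inj_surj)
    have "[(\<Sum>u\<in>U. h (x + u) ^ j - h x ^ j) = (\<Sum>u\<in>U. (h x + \<phi> u) ^ j - h x ^ j)] (mod int p)"
      by (intro cong_sum cong_diff cong_pow) (simp_all add: \<phi>_def cong_def mod_simps)
    also have "(\<Sum>u\<in>U. (h x + \<phi> u) ^ j - h x ^ j) = (\<Sum>u\<in>U. (h x + u) ^ j - h x ^ j)"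
      using sum.reindex[OF inj_\<phi>, of "\<lambda>u. (h x + u) ^ j - h x ^ j"] im by simp
    also have "[\<dots> = (\<Sum>u\<in>U. u ^ j)] (mod int p)"
      using shift_sum_power_const[of r "int p" U j] least j by blast
    finally show ?thesis .
  qed

  obtain g where g: "degree g < p" "\<And>x. [poly g x = h x] (mod int p)"
    "degree g = 0 \<or> \<not> int p dvd lead_coeff g"
    using interpolation_mod_prime[OF p, of h] inj by blast
  \<comment> \<open>\<open>g ^ j\<close> has a leading coefficient prime to \<open>p\<close>, and by
    \<open>shift\<close> its sum over the shifts is constant modulo \<open>p\<close>. That is
    impossible in a degree above \<open>r\<close> and below \<open>p\<close>.\<close>
  have small: "j * degree g \<le> r"
    if j: "1 \<le> j" "j \<le> r" and lt: "j * degree g < p" and pos: "degree g \<noteq> 0" for j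
  proof (rule ccontr)
    assume "\<not> ?thesis"
    moreover have "g \<noteq> 0"
      using pos by auto
    then have deg: "degree (g ^ j) = j * degree g"
      by (rule degree_power_eq)
    moreover have "\<not> int p dvd lead_coeff (g ^ j)"
      using g(3) pos p prime_dvd_power[of "int p" "lead_coeff g" j]
      by (auto simp: lead_coeff_power)
    ultimately obtain x where
      "\<not> [(\<Sum>u\<in>U. poly (g ^ j) (x + u) - poly (g ^ j) x) = (\<Sum>u\<in>U. u ^ j)] (mod int p)"
      using shift_sum_poly_not_const[of p r U "g ^ j" "\<Sum>u\<in>U. u ^ j"] p \<open>Q r\<close> least lt
      unfolding Q_def by auto
    moreover have "[(\<Sum>u\<in>U. poly (g ^ j) (x + u) - poly (g ^ j) x) =
        (\<Sum>u\<in>U. h (x + u) ^ j - h x ^ j)] (mod int p)"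
      unfolding poly_power by (intro cong_sum cong_diff cong_pow g(2))
    ultimately show False
      using shift[OF j] cong_trans by blast
  qed
  have "degree g \<le> 1"
  proof (rule ccontr)
    assume "\<not> ?thesis"
    then have n: "2 \<le> degree g"
      by simp
    have "1 \<le> r"
      using \<open>Q r\<close> by (simp add: Q_def)
    then have "degree g \<le> r"
      using small[of 1] g(1) n by simp
    \<comment> \<open>This makes j * degree g the first multiple exceeding \<open>r\<close>, at most
      r + degree g \<le> 2r < p. Also j \<le> r, because 2 \<le> degree g \<le> r, so
      \<open>small\<close> applies.\<close>
    define j where "j = r div degree g + 1"
    have "r div degree g \<le> r div 2"
      using n by (simp add: div_le_mono2)
    then have "j \<le> r"
      using n \<open>degree g \<le> r\<close> unfolding j_def by linarith
    have "r mod degree g < degree g"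
      using n by simp
    moreover have "j * degree g = r div degree g * degree g + degree g"
      by (simp add: j_def)
    ultimately have "r < j * degree g" "j * degree g \<le> r + degree g"
      using div_mult_mod_eq[of r "degree g"] by linarith+
    moreover from this have "j * degree g < p"
      using \<open>degree g \<le> r\<close> \<open>r \<le> card U\<close> U(3) by linarith
    ultimately show False
      using small[of j] \<open>j \<le> r\<close> n by (simp add: j_def)
  qed
  then have "poly g x = coeff g 1 * x + coeff g 0" for x
    by (cases "degree g") (auto simp: poly_altdef coeff_eq_0)
  then show ?thesis
    using g(2) by (metis cong_sym)
qed

text \<open>The nonzero differences outside \<open>U\<close> are preserved too, and either
  \<open>U\<close> or its complement has fewer than p/2 elements. The complement is nonempty because
  \<open>U\<close> is proper.\<close>

theorem difference_preserving_affine: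
  fixes U :: "int set" and h :: "int \<Rightarrow> int"
  assumes p: "prime p" and U: "U \<subseteq> {1..<int p}" "U \<noteq> {}" "U \<noteq> {1..<int p}"
    and inj: "\<And>x y. [h x = h y] (mod int p) \<longleftrightarrow> [x = y] (mod int p)"
    and pres: "\<And>x y. (h x - h y) mod int p \<in> U \<longleftrightarrow> (x - y) mod int p \<in> U"
  shows "\<exists>a b. \<forall>x. [h x = a * x + b] (mod int p)"
proof (cases "2 * card U < p")
  case True
  then show ?thesis
    using difference_preserving_affine_if_card_le[OF p U(1,2)] inj pres by blast
next
  case False
  let ?V = "{1..<int p} - U"
  have "card ?V = p - 1 - card U"
    using U(1) by (subst card_Diff_subset) (auto intro: finite_subset)
  then have "2 * card ?V < p"
    using False prime_gt_0_nat[OF p] by simp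
  moreover have V: "z mod int p \<in> ?V \<longleftrightarrow> z mod int p \<noteq> 0 \<and> z mod int p \<notin> U" for z
    using prime_gt_0_nat[OF p] pos_mod_bound[of "int p" z] pos_mod_sign[of "int p" z]
    by (auto simp: le_less simp del: pos_mod_bound pos_mod_sign)
  have "(h x - h y) mod int p \<in> ?V" if "(x - y) mod int p \<in> ?V" for x y
    using that inj[of x y] pres[of x y] unfolding V by (simp add: cong_iff_dvd_diff dvd_eq_mod_eq_0)
  ultimately show ?thesis
    using difference_preserving_affine_if_card_le[OF p, of ?V] U inj by blast
qed

section \<open>The column group\<close>

text \<open>The left factor moves row \<open>i\<close> to row \<open>\<pi> i\<close>, and the right
  factor puts column \<open>\<sigma> j\<close> in place \<open>j\<close>. Reading off at row
  \<open>\<pi> i\<close> avoids an inverse.\<close>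

lemma permutation_mat_mult_index:
  fixes C :: "'a::semiring_1 mat"
  assumes C: "C \<in> carrier_mat n p" and \<pi>: "\<pi> permutes {..<n}" and \<sigma>: "\<sigma> permutes {..<p}"
    and ij: "i < n" "j < p"
  shows "(permutation_mat n \<pi> * C * permutation_mat p \<sigma>) $$ (\<pi> i, j) = C $$ (i, \<sigma> j)"
proof -
  let ?P = "permutation_mat n \<pi> :: 'a mat" and ?Q = "permutation_mat p \<sigma> :: 'a mat"
  have lt: "\<pi> i < n" "\<sigma> j < p"
    using permutes_in_image[OF \<pi>, of i] permutes_in_image[OF \<sigma>, of j] ij by auto
  have "(?P * C) $$ (\<pi> i, l) = C $$ (i, l)" if "l < p" for l
  proof -
    have "(?P * C) $$ (\<pi> i, l) = (\<Sum>k<n. (if \<pi> i = \<pi> k then 1 else 0) * C $$ (k, l))"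
      using C lt that by (simp add: permutation_mat_def scalar_prod_def lessThan_atLeast0)
    also have "\<dots> = (\<Sum>k<n. if k = i then C $$ (k, l) else 0)"
      using inj_eq[OF permutes_inj[OF \<pi>]] by (intro sum.cong) auto
    finally show ?thesis
      using ij by simp
  qed
  moreover have "(?P * C * ?Q) $$ (\<pi> i, j) = (\<Sum>l<p. (?P * C) $$ (\<pi> i, l) * (if l = \<sigma> j then 1 else 0))"
    using C lt ij by (simp add: permutation_mat_def scalar_prod_def lessThan_atLeast0)
  ultimately have "(?P * C * ?Q) $$ (\<pi> i, j) = (\<Sum>l<p. if l = \<sigma> j then C $$ (i, l) else 0)"
    by (simp add: if_distrib[of "\<lambda>t. _ * t"] cong: if_cong sum.cong)
  then show ?thesis
    using lt by simp
qed

text \<open>\<open>\<rho>\<close> is the inverse of the row permutation in the matrix equation. In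
  this form the pair of permutations is an automorphism of the row-column incidence.\<close>

lemma column_group_iff:
  assumes C: "C \<in> carrier_mat n p"
  shows "\<sigma> \<in> column_group C \<longleftrightarrow> \<sigma> permutes {..<p} \<and>
    (\<exists>\<rho>. \<rho> permutes {..<n} \<and> (\<forall>i<n. \<forall>j<p. C $$ (\<rho> i, \<sigma> j) = C $$ (i, j)))"
    (is "_ \<longleftrightarrow> _ \<and> (\<exists>\<rho>. ?R \<rho>)")
proof
  assume "\<sigma> \<in> column_group C"
  then obtain \<pi> where \<sigma>: "\<sigma> permutes {..<p}" and \<pi>: "\<pi> permutes {..<n}"
    and eq: "permutation_mat n \<pi> * C * permutation_mat p \<sigma> = C"
    using C by (auto simp: column_group_def)
  have "C $$ (inv_into UNIV \<pi> i, \<sigma> j) = C $$ (i, j)" if "i < n" "j < p" for i j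
    using permutation_mat_mult_index[OF C \<pi> \<sigma>, of "inv_into UNIV \<pi> i" j] that eq
      permutes_inverses(1)[OF \<pi>] permutes_in_image[OF permutes_inv[OF \<pi>], of i] by simp
  then have "?R (inv_into UNIV \<pi>)"
    using permutes_inv[OF \<pi>] by blast
  with \<sigma> show "\<sigma> permutes {..<p} \<and> (\<exists>\<rho>. ?R \<rho>)"
    by blast
next
  assume "\<sigma> permutes {..<p} \<and> (\<exists>\<rho>. ?R \<rho>)"
  then obtain \<rho> where \<sigma>: "\<sigma> permutes {..<p}" and \<rho>: "\<rho> permutes {..<n}"
    and eq: "\<forall>i<n. \<forall>j<p. C $$ (\<rho> i, \<sigma> j) = C $$ (i, j)"
    by blast
  have "permutation_mat n (inv_into UNIV \<rho>) * C * permutation_mat p \<sigma> = C"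
  proof (rule eq_matI)
    fix i j assume ij: "i < dim_row C" "j < dim_col C"
    then have "\<rho> i < n"
      using permutes_in_image[OF \<rho>, of i] C by simp
    then show "(permutation_mat n (inv_into UNIV \<rho>) * C * permutation_mat p \<sigma>) $$ (i, j) = C $$ (i, j)"
      using permutation_mat_mult_index[OF C permutes_inv[OF \<rho>] \<sigma>, of "\<rho> i" j] C ij eq
      by (simp add: permutes_inverses(2)[OF \<rho>])
  qed (use C in \<open>simp_all add: permutation_mat_def\<close>)
  then show "\<sigma> \<in> column_group C"
    using \<sigma> C permutes_inv[OF \<rho>] by (auto simp: column_group_def)
qed

section \<open>Cyclic symmetry of stacked circulant matrices\<close>

lemma circulant_shift:
  assumes A: "circulant A" "A \<in> carrier_mat p p" and ij: "i < p" "j < p"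
  shows "A $$ (Suc i mod p, Suc j mod p) = A $$ (i, j)"
proof -
  have step: "A $$ (Suc k, Suc l mod p) = A $$ (k, l)" if "Suc k < p" "l < p" for k l
    using that A by (auto simp: circulant_def)
  show ?thesis
  proof (cases "Suc i < p")
    case True
    then show ?thesis
      using step ij by simp
  next
    case False
    then have i: "Suc i = p"
      using ij by simp
    \<comment> \<open>Only consecutive rows are related by definition. The wrap from the last row to
      the first comes from following a diagonal through all rows: p - 1 steps right equal one step
      left.\<close>
    have "A $$ (k, (l + k) mod p) = A $$ (0, l)" if "k < p" "l < p" for k l
      using that
    proof (induction k)
      case (Suc k)
      then show ?case
        using step[of k "(l + k) mod p"] by (simp add: mod_Suc_eq)
    qed simp
    from this[of i "Suc j mod p"] have "A $$ (i, (Suc j + i) mod p) = A $$ (0, Suc j mod p)"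
      using ij by (simp add: mod_simps)
    moreover have "(Suc j + i) mod p = (j + p) mod p"
      using i by (metis add_Suc_shift)
    ultimately show ?thesis
      using i ij by simp
  qed
qed

lemma Suc_mod_inj:
  assumes "Suc a mod p = Suc b mod p" "a < p" "b < p"
  shows "a = b"
  using assms by (auto simp: mod_Suc split: if_splits)

lemma inj_endo_permutes:
  assumes "finite A" "f ` A \<subseteq> A" "inj_on f A" "\<And>x. x \<notin> A \<Longrightarrow> f x = x"
  shows "f permutes A"
  using assms endo_inj_surj[of A f] by (intro bij_imp_permutes) (auto simp: bij_betw_def)

text \<open>The column shift is matched by shifting the rows cyclically within every block:
  \<open>\<rho>\<close> keeps the block index i div p and advances i mod p.\<close>

lemma stack_circulant_shift_in_column_group:
  fixes B :: "nat \<Rightarrow> 'a::semiring_1 mat"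
  assumes p: "0 < p" and B: "\<And>b. b < k \<Longrightarrow> B b \<in> carrier_mat p p \<and> circulant (B b)"
  shows "(\<lambda>j. if j < p then Suc j mod p else j) \<in> column_group (stack_blocks k p p B)"
proof -
  let ?\<sigma> = "\<lambda>j. if j < p then Suc j mod p else j" and ?C = "stack_blocks k p p B"
  define \<rho> where "\<rho> i = (if i < k * p then i div p * p + Suc (i mod p) mod p else i)" for i
  have dm: "\<rho> i div p = i div p" "\<rho> i mod p = Suc (i mod p) mod p" if "i < k * p" for i
    using that p by (simp_all add: \<rho>_def)
  have \<rho>_lt: "\<rho> i < k * p" if "i < k * p" for i
    using dm(1)[OF that] that div_less_iff_less_mult[OF p, of "\<rho> i" k]
      div_less_iff_less_mult[OF p, of i k] by simp
  have "inj_on \<rho> {..<k * p}"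
  proof (rule inj_onI)
    fix i i' assume *: "i \<in> {..<k * p}" "i' \<in> {..<k * p}" "\<rho> i = \<rho> i'"
    then have "Suc (i mod p) mod p = Suc (i' mod p) mod p"
      using dm(2)[of i] dm(2)[of i'] by simp
    then have "i mod p = i' mod p"
      using Suc_mod_inj[of "i mod p" p "i' mod p"] p by simp
    moreover have "i div p = i' div p"
      using dm(1)[of i] dm(1)[of i'] * by simp
    ultimately show "i = i'"
      by (metis div_mult_mod_eq)
  qed
  then have \<rho>: "\<rho> permutes {..<k * p}"
    using \<rho>_lt by (intro inj_endo_permutes) (auto simp: \<rho>_def)
  have "inj_on ?\<sigma> {..<p}"
    by (rule inj_onI) (auto intro: Suc_mod_inj)
  then have \<sigma>: "?\<sigma> permutes {..<p}"
    using p by (intro inj_endo_permutes) auto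
  have "?C $$ (\<rho> i, ?\<sigma> j) = ?C $$ (i, j)" if ij: "i < k * p" "j < p" for i j
  proof -
    have "i div p < k"
      using ij p by (simp add: div_less_iff_less_mult)
    then show ?thesis
      using ij p \<rho>_lt[OF ij(1)] dm[OF ij(1)] circulant_shift[of "B (i div p)" p "i mod p" j] B
      by (simp add: stack_blocks_def)
  qed
  moreover have "?C \<in> carrier_mat (k * p) p"
    by (simp add: stack_blocks_def)
  ultimately show ?thesis
    using \<rho> \<sigma> column_group_iff by blast
qed

text \<open>Fixed points solve (a - 1) x + b = 0 modulo \<open>p\<close>. Two distinct solutions
  force a = 1 and b = 0, that is, the identity.\<close>

lemma affine_permutation_moved_points:
  assumes p: "prime p" and \<sigma>: "\<sigma> permutes {..<p}" "\<sigma> \<noteq> id"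
    and affine: "\<And>j. j < p \<Longrightarrow> [int (\<sigma> j) = a * int j + b] (mod int p)"
  shows "p - 1 \<le> card {j. \<sigma> j \<noteq> j}"
proof -
  let ?F = "{j. j < p \<and> \<sigma> j = j}"
  have unique: "j = k" if jk: "j \<in> ?F" "k \<in> ?F" for j k
  proof (rule ccontr)
    assume "j \<noteq> k"
    have fixed: "int p dvd (a - 1) * int l + b" if "l \<in> ?F" for l
      using affine[of l] that by (auto simp: cong_iff_dvd_diff dvd_diff_commute algebra_simps)
    then have "int p dvd ((a - 1) * int j + b) - ((a - 1) * int k + b)"
      using jk by (intro dvd_diff) blast+
    then have "int p dvd (a - 1) * (int j - int k)"
      by (simp add: algebra_simps)
    moreover have "\<not> int p dvd int j - int k"
      using \<open>j \<noteq> k\<close> jk by (auto simp flip: mod_eq_dvd_iff)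
    ultimately have a: "int p dvd a - 1"
      using p by (simp add: prime_dvd_mult_iff)
    then have b: "int p dvd b"
      using fixed[OF jk(1)] by (simp add: dvd_add_right_iff)
    have "\<sigma> l = l" for l
    proof (cases "l < p")
      case True
      have "int p dvd (a - 1) * int l + b"
        using a b by simp
      then have "[a * int l + b = int l] (mod int p)"
        by (simp add: cong_iff_dvd_diff algebra_simps)
      then have "[\<sigma> l = l] (mod p)"
        using affine[OF True] by (metis cong_int_iff cong_trans)
      then show ?thesis
        using True permutes_in_image[OF \<sigma>(1), of l] by (simp add: cong_def)
    qed (use \<sigma>(1) in \<open>simp add: permutes_def\<close>)
    then show False
      using \<sigma>(2) by auto
  qed
  have "card ?F \<le> Suc 0 \<longleftrightarrow> (\<forall>j\<in>?F. \<forall>k\<in>?F. j = k)"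
    by (rule card_le_Suc0_iff_eq) simp
  then have "card ?F \<le> 1"
    unfolding One_nat_def using unique by blast
  moreover have "{j. \<sigma> j \<noteq> j} = {..<p} - ?F"
    using \<sigma>(1) by (auto simp: permutes_def)
  moreover have "card ({..<p} - ?F) = p - card ?F"
    by (subst card_Diff_subset) auto
  ultimately show ?thesis
    by simp
qed

section \<open>Column adjacency and the minimal degree\<close>

theorem lemma3p2p10:
  fixes p m t t\<^sub>r :: nat and B :: "nat \<Rightarrow> bit mat" and C :: "bit mat"
  assumes "prime p"
    and "m \<ge> 2"
    and "\<And>i. i < m - 1 \<Longrightarrow> B i \<in> carrier_mat p p \<and> circulant (B i)"
    and "C = stack_blocks (m - 1) p p B"
    and "\<And>j. j < p \<Longrightarrow> weight (col C j) = t"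
    and "\<And>i. i < (m - 1) * p \<Longrightarrow> weight (row C i) = t\<^sub>r"
    and "t\<^sub>r \<ge> 2"
    and "\<exists>i < m - 1. invertible_mat (B i)"
    and "\<And>j k. j < p \<Longrightarrow> k < p \<Longrightarrow> j \<noteq> k \<Longrightarrow>
           card {i. i < (m - 1) * p \<and> C $$ (i, j) = 1 \<and> C $$ (i, k) = 1} \<le> 1"
    and "t * t\<^sub>r \<le> p - 1"
  shows "minimal_degree (column_group C) \<ge> p - 1"
proof -
  define n where "n = (m - 1) * p"
  define adj where "adj j k \<longleftrightarrow> (\<exists>i<n. C $$ (i, j) \<noteq> 0 \<and> C $$ (i, k) \<noteq> 0)" for j k
  define U where "U = {u \<in> {1..<int p}. adj 0 (nat u)}"
  let ?s = "\<lambda>j. if j < p then Suc j mod p else j"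
  have p: "1 < p"
    using \<open>prime p\<close> by (rule prime_gt_1_nat)
  have C: "C \<in> carrier_mat n p"
    using assms(4) by (simp add: stack_blocks_def n_def)
  have s_in: "?s \<in> column_group C"
    unfolding assms(4) using assms(3) p by (intro stack_circulant_shift_in_column_group) auto
  have adj_inv: "adj (\<sigma> j) (\<sigma> k) \<longleftrightarrow> adj j k"
    if \<sigma>: "\<sigma> \<in> column_group C" and jk: "j < p" "k < p" for \<sigma> j k
  proof -
    obtain \<rho> where \<rho>: "\<rho> permutes {..<n}" and eq: "\<forall>i<n. \<forall>j<p. C $$ (\<rho> i, \<sigma> j) = C $$ (i, j)"
      using column_group_iff[OF C, THEN iffD1, OF \<sigma>] by blast
    have "adj (\<sigma> j) (\<sigma> k) \<longleftrightarrow> (\<exists>i\<in>\<rho> ` {..<n}. C $$ (i, \<sigma> j) \<noteq> 0 \<and> C $$ (i, \<sigma> k) \<noteq> 0)"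
      unfolding permutes_image[OF \<rho>] adj_def by blast
    also have "\<dots> \<longleftrightarrow> (\<exists>i<n. C $$ (\<rho> i, \<sigma> j) \<noteq> 0 \<and> C $$ (\<rho> i, \<sigma> k) \<noteq> 0)"
      by blast
    also have "\<dots> \<longleftrightarrow> adj j k"
      unfolding adj_def using eq jk by (simp cong: conj_cong)
    finally show ?thesis .
  qed
  \<comment> \<open>Iterating the shift automorphism \<open>?s\<close> moves the pair 0, d to any
    pair with the same difference.\<close>
  have adj_add: "adj (a mod p) ((a + d) mod p) \<longleftrightarrow> adj 0 d" if "d < p" for a d
  proof (induction a)
    case (Suc a)
    then show ?case
      using adj_inv[OF s_in, of "a mod p" "(a + d) mod p"] p by (simp add: mod_simps)
  qed (use that in simp)
  have U_iff: "(x - y) mod int p \<in> U \<longleftrightarrow>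
      \<not> [x = y] (mod int p) \<and> adj (nat (y mod int p)) (nat (x mod int p))" for x y
  proof -
    define d where "d = (x - y) mod int p"
    have d: "0 \<le> d" "d < int p"
      using p by (simp_all add: d_def)
    have "(y mod int p + d) mod int p = x mod int p"
      by (simp add: d_def mod_simps)
    moreover have "int ((nat (y mod int p) + nat d) mod p) = (y mod int p + d) mod int p"
      using d p by (simp add: zmod_int)
    ultimately have "(nat (y mod int p) + nat d) mod p = nat (x mod int p)"
      by (metis nat_int)
    then have "adj (nat (y mod int p)) (nat (x mod int p)) \<longleftrightarrow> adj 0 (nat d)"
      using adj_add[of "nat d" "nat (y mod int p)"] d p by (simp add: nat_less_iff)
    moreover have "[x = y] (mod int p) \<longleftrightarrow> d = 0"
      by (simp add: d_def cong_iff_dvd_diff dvd_eq_mod_eq_0)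
    ultimately show ?thesis
      using d unfolding U_def d_def[symmetric] by auto
  qed

  \<comment> \<open>Row 0 exists since m \<ge> 2, and two of its at least two nonzero entries lie in
    distinct adjacent columns.\<close>
  have "U \<noteq> {}"
  proof -
    have "0 < n"
      using assms(2) p by (simp add: n_def)
    then have "card {j. j < p \<and> C $$ (0, j) \<noteq> 0} = t\<^sub>r"
      using assms(6)[of 0] C by (simp add: weight_def n_def cong: conj_cong)
    then have "\<not> card {j. j < p \<and> C $$ (0, j) \<noteq> 0} \<le> Suc 0"
      using assms(7) by simp
    then obtain j k where "j < p" "k < p" "j \<noteq> k" "C $$ (0, j) \<noteq> 0" "C $$ (0, k) \<noteq> 0"
      by (subst (asm) card_le_Suc0_iff_eq) auto
    then have "(int j - int k) mod int p \<in> U"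
      using \<open>0 < n\<close> unfolding U_iff adj_def by (auto simp: cong_int_iff cong_def)
    then show ?thesis
      by blast
  qed
  moreover have "U \<noteq> {1..<int p}"
  proof
    assume full: "U = {1..<int p}"
    let ?R = "{i. i < n \<and> C $$ (i, 0) \<noteq> 0}" and ?S = "\<lambda>i. {j. j < p \<and> C $$ (i, j) \<noteq> 0}"
    have R: "card ?R = t"
      using assms(5)[of 0] C p by (simp add: weight_def cong: conj_cong)
    have S: "card (?S i - {0}) = t\<^sub>r - 1" if "i \<in> ?R" for i
    proof -
      have "card (?S i) = t\<^sub>r"
        using assms(6)[of i] C that by (simp add: weight_def n_def cong: conj_cong)
      then show ?thesis
        using that p by (subst card_Diff_singleton) auto
    qed
    have "{1..<p} \<subseteq> (\<Union>i\<in>?R. ?S i - {0})"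
    proof
      fix j assume j: "j \<in> {1..<p}"
      then have "int j \<in> U"
        unfolding full by auto
      then show "j \<in> (\<Union>i\<in>?R. ?S i - {0})"
        using j by (auto simp: U_def adj_def)
    qed
    then have "card {1..<p} \<le> card (\<Union>i\<in>?R. ?S i - {0})"
      by (intro card_mono) auto
    also have "\<dots> \<le> (\<Sum>i\<in>?R. card (?S i - {0}))"
      by (intro card_UN_le) auto
    also have "\<dots> = t * (t\<^sub>r - 1)"
      using R S by simp
    finally have "p - 1 \<le> t * t\<^sub>r - t"
      by (simp add: algebra_simps)
    with assms(10) p have "t = 0"
      by (cases t) auto
    with \<open>p - 1 \<le> t * t\<^sub>r - t\<close> p show False
      by simp
  qed
  \<comment> \<open>\<open>\<sigma>\<close> is lifted to the integers through the representatives 0,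
    ..., p - 1.\<close>
  ultimately have affine: "\<exists>a b. \<forall>x. [int (\<sigma> (nat (x mod int p))) = a * x + b] (mod int p)"
    if \<sigma>: "\<sigma> \<in> column_group C" for \<sigma>
  proof (intro difference_preserving_affine[of p U] \<open>prime p\<close>)
    let ?h = "\<lambda>x. int (\<sigma> (nat (x mod int p)))"
    have perm: "\<sigma> permutes {..<p}"
      using column_group_iff[OF C, THEN iffD1, OF \<sigma>] by blast
    have lt: "nat (x mod int p) < p" for x
      using p by (simp add: nat_less_iff)
    then have \<sigma>_lt: "\<sigma> (nat (x mod int p)) < p" for x
      using permutes_in_image[OF perm] by simp
    show inj: "[?h x = ?h y] (mod int p) \<longleftrightarrow> [x = y] (mod int p)" for x y
    proof -
      have "[?h x = ?h y] (mod int p) \<longleftrightarrow> nat (x mod int p) = nat (y mod int p)"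
        using \<sigma>_lt inj_eq[OF permutes_inj[OF perm]] by (simp add: cong_int_iff cong_def)
      also have "\<dots> \<longleftrightarrow> [x = y] (mod int p)"
        using p by (simp add: cong_def eq_nat_nat_iff)
      finally show ?thesis .
    qed
    show "(?h x - ?h y) mod int p \<in> U \<longleftrightarrow> (x - y) mod int p \<in> U" for x y
      unfolding U_iff inj using adj_inv[OF \<sigma> lt lt, of y x] \<sigma>_lt by (simp flip: of_nat_mod)
  qed (auto simp: U_def)

  have "p - 1 \<le> card {j. \<sigma> j \<noteq> j}" if \<sigma>: "\<sigma> \<in> column_group C" "\<sigma> \<noteq> id" for \<sigma>
  proof -
    obtain a b where ab: "[int (\<sigma> (nat (x mod int p))) = a * x + b] (mod int p)" for x
      using affine[OF \<sigma>(1)] by blast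
    have "[int (\<sigma> j) = a * int j + b] (mod int p)" if "j < p" for j
      using ab[of "int j"] that by simp
    moreover have "\<sigma> permutes {..<p}"
      using column_group_iff[OF C, THEN iffD1, OF \<sigma>(1)] by blast
    ultimately show ?thesis
      using affine_permutation_moved_points[OF \<open>prime p\<close>] \<sigma>(2) by blast
  qed
  \<comment> \<open>A non-identity element makes the set under \<open>Min\<close> nonempty;
    otherwise its value would be unspecified.\<close>
  moreover have "?s \<noteq> id"
    using p by (auto simp: fun_eq_iff intro!: exI[of _ 0])
  moreover have "finite (column_group C)"
    using C by (intro finite_subset[OF _ finite_permutations[of "{..<p}"]])
      (auto simp: column_group_def)
  ultimately show ?thesis
    unfolding minimal_degree_def using s_in by (intro Min.boundedI) auto
qed

end
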